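(* Let $a\in\mathbb{C}$ with $|a|=\sqrt2$ and let $N=\begin{pmatrix}0&a&0\\0&0&a\\0&0&0\end{pmatrix}$. Then the Harnack part of $N$ in $C_2(\mathbb{C}^3)$ is the set of all matrices of $C_2(\mathbb{C}^3)$ of the form $$T=a\begin{pmatrix}0&e^{-i\theta}&0\\0&0&e^{i\theta}\\0&0&0\end{pmatrix},\qquad\theta\in\mathbb{R}.$$
   Context: $C_2(\mathbb{C}^3)$ is the set of $3\times3$ complex matrices $T$ whose numerical radius $w(T)=\sup\{|\langle Tx,x\rangle|:\|x\|=1\}$ is at most $1$. For $T\in C_2(\mathbb{C}^3)$ and $z$ in the open unit disc $\mathbb{D}$, put $K_z^2(T)=(I-\overline{z}T)^{-1}+(I-zT^* )^{-1}$. For $T_0,T_1\in C_2(\mathbb{C}^3)$, $T_1$ is Harnack dominated by $T_0$ if there is a constant $c\ge 1$ with $K_z^2(T_1)\le c^2K_z^2(T_0)$ for all $z\in\mathbb{D}$; they are Harnack equivalent if each is Harnack dominated by the other. The Harnack part of $T$ is its equivalence class under Harnack equivalence. *)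

theory Defs
  imports "HOL-Analysis.Analysis"
begin

(* Conjugate-linear in the second argument; the library's inner is its real part, and the
   library's norm on complex ^ 'n is the one it induces. *)
definition cinner :: "complex ^ 'n \<Rightarrow> complex ^ 'n \<Rightarrow> complex"
  where "cinner x y = (\<Sum>i\<in>UNIV. x $ i * cnj (y $ i))"

definition scaleC_matrix :: "complex \<Rightarrow> complex ^ 'n ^ 'm \<Rightarrow> complex ^ 'n ^ 'm"  (infixr \<open>*\<^sub>C\<close> 75)
  where "c *\<^sub>C A = map_matrix ((*) c) A"

definition conj_transpose :: "complex ^ 'n ^ 'm \<Rightarrow> complex ^ 'm ^ 'n"
  where "conj_transpose A = map_matrix cnj (transpose A)"

definition numerical_radius :: "complex ^ 'n ^ 'n \<Rightarrow> real"
  where "numerical_radius T = (SUP x\<in>{x. norm x = 1}. cmod (cinner (T *v x) x))"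

definition C2 :: "(complex ^ 'n ^ 'n) set"
  where "C2 = {T. numerical_radius T \<le> 1}"

definition loewner_le :: "complex ^ 'n ^ 'n \<Rightarrow> complex ^ 'n ^ 'n \<Rightarrow> bool"
  where "loewner_le A B \<longleftrightarrow>
    (\<forall>x. cinner ((B - A) *v x) x \<in> \<real> \<and> 0 \<le> Re (cinner ((B - A) *v x) x))"

(* For T in C2 the spectral radius of T is at most 1, so both inverses exist when cmod z < 1. *)
definition harnack_kernel :: "complex \<Rightarrow> complex ^ 'n ^ 'n \<Rightarrow> complex ^ 'n ^ 'n"
  where "harnack_kernel z T =
    matrix_inv (mat 1 - cnj z *\<^sub>C T) + matrix_inv (mat 1 - z *\<^sub>C conj_transpose T)"

(* "T1 is Harnack dominated by T0"; membership of both matrices in C2 is part of the relation. *)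
definition harnack_dominated :: "complex ^ 'n ^ 'n \<Rightarrow> complex ^ 'n ^ 'n \<Rightarrow> bool"
  where "harnack_dominated T1 T0 \<longleftrightarrow> T1 \<in> C2 \<and> T0 \<in> C2 \<and>
    (\<exists>c::real. c \<ge> 1 \<and>
      (\<forall>z. cmod z < 1 \<longrightarrow> loewner_le (harnack_kernel z T1) (c\<^sup>2 *\<^sub>R harnack_kernel z T0)))"

definition harnack_equivalent :: "complex ^ 'n ^ 'n \<Rightarrow> complex ^ 'n ^ 'n \<Rightarrow> bool"
  where "harnack_equivalent S T \<longleftrightarrow> harnack_dominated S T \<and> harnack_dominated T S"

definition harnack_part :: "complex ^ 'n ^ 'n \<Rightarrow> (complex ^ 'n ^ 'n) set"
  where "harnack_part T = {S. harnack_equivalent S T}"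

end

(*
  With F(w) = (I - wT)^-1 the kernel is F + F^* at w = cnj z, so Harnack domination compares the forms
  Re <F(w)x, x>.

  For the matrices of the stated shape these forms are polynomials in w whose degenerate directions
  on the circle do not depend on theta, which gives domination on the circle; the maximum
  principle carries it into the disc.

  Conversely, on the circle the kernel of N annihilates x(w) = v + w^2 u with v = e_3 and
  u = -(a^2/2) e_1. If N dominates T, then by Cauchy-Schwarz the kernel of T at rw applied to x(w) tends
  to 0 as r -> 1. Pairing it with a fixed y gives the real part of a holomorphic function of w; by the
  maximum principle this real part vanishes in the whole disc in the limit, so the function is
  constant. Comparing coefficients gives T^*v = 0, Tu = 0, T^*u + Tv = 0 and TT^*u = 2u, which leave only the stated matrices.
*)
theory Submission
  imports Defs "HOL-Complex_Analysis.Conformal_Mappings"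
begin

section \<open>The form on complex vectors\<close>

lemma cinner_add_left: "cinner (x + y) z = cinner x z + cinner y z"
  and cinner_add_right: "cinner x (y + z) = cinner x y + cinner x z"
  and cinner_diff_left: "cinner (x - y) z = cinner x z - cinner y z"
  and cinner_scale_left: "cinner (c *s x) z = c * cinner x z"
  and cinner_scale_right: "cinner x (c *s z) = cnj c * cinner x z"
  and cinner_zero_left: "cinner 0 z = 0"
  by (simp_all add: cinner_def algebra_simps sum.distrib sum_subtractf sum_distrib_left)

lemma cinner_commute: "cinner y x = cnj (cinner x y)"
  by (simp add: cinner_def mult.commute)

lemma Re_cinner_commute: "Re (cinner y x) = Re (cinner x y)"
  by (simp add: cinner_commute[of y x])

lemma cinner_self: "cinner x x = of_real ((norm x)\<^sup>2)"
proof -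
  have "(norm x)\<^sup>2 = (\<Sum>i\<in>UNIV. (cmod (x $ i))\<^sup>2)"
    by (simp add: norm_vec_def L2_set_def sum_nonneg)
  then show ?thesis
    by (simp add: cinner_def complex_norm_square del: of_real_power)
qed

lemma cinner_axis_right: "cinner x (axis i 1) = x $ i"
  by (simp add: cinner_def axis_def if_distrib[of cnj] if_distrib[of "(*) _"] cong: if_cong)

lemma cinner_conj_transpose: "cinner (conj_transpose A *v x) y = cinner x (A *v y)"
  unfolding cinner_def conj_transpose_def map_matrix_def matrix_vector_mult_def transpose_def
  by (simp add: sum_distrib_left sum_distrib_right mult_ac) (rule sum.swap)

lemma cinner_conj_transpose_right: "cinner x (conj_transpose A *v y) = cinner (A *v x) y"
  by (metis cinner_commute cinner_conj_transpose)

lemma continuous_cinner [continuous_intros]: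
  "continuous_on S f \<Longrightarrow> continuous_on S g \<Longrightarrow> continuous_on S (\<lambda>x. cinner (f x) (g x))"
  unfolding cinner_def by (intro continuous_intros)

lemma holomorphic_cinner:
  "(\<And>i. (\<lambda>w. f w $ i) holomorphic_on S) \<Longrightarrow> (\<lambda>w. cinner (f w) y) holomorphic_on S"
  unfolding cinner_def by (intro holomorphic_intros)

lemma scaleC_matrix_vector: "(c *\<^sub>C A) *v x = c *s (A *v x)"
  by (simp add: vec_eq_iff scaleC_matrix_def map_matrix_def matrix_vector_mult_def
      sum_distrib_left mult.assoc)

lemma matrix_vector_scale: "A *v (c *s x) = c *s (A *v x)" for A :: "complex ^ 'n ^ 'm"
  by (simp add: vec_eq_iff matrix_vector_mult_def sum_distrib_left mult_ac)

lemma norm_vector_scale: "norm (c *s x) = cmod c * norm x" for x :: "complex ^ 'n"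
  by (simp add: norm_vec_def norm_mult L2_set_right_distrib)

text \<open>A supremum of reals bounds its terms only if they are bounded above; compactness of the
  unit sphere supplies this. Homogeneity of degree two then extends the bound from unit vectors to
  all \<open>x\<close>.\<close>

lemma C2_iff: "T \<in> C2 \<longleftrightarrow> (\<forall>x. cmod (cinner (T *v x) x) \<le> (norm x)\<^sup>2)"
  for T :: "complex ^ 'n ^ 'n"
proof
  assume T: "T \<in> C2"
  let ?f = "\<lambda>x. cmod (cinner (T *v x) x)"
  have "compact (?f ` sphere 0 1)"
    by (intro compact_continuous_image continuous_intros compact_sphere)
  then have bdd: "bdd_above (?f ` {x. norm x = 1})"
    by (auto simp: sphere_def dest: compact_imp_bounded bounded_imp_bdd_above)
  show "\<forall>x. ?f x \<le> (norm x)\<^sup>2"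
  proof
    fix x :: "complex ^ 'n"
    show "?f x \<le> (norm x)\<^sup>2"
    proof (cases "x = 0")
      case False
      define u where "u = complex_of_real (inverse (norm x)) *s x"
      have "norm u = 1"
        using False by (simp add: u_def norm_vector_scale norm_inverse)
      then have "?f u \<le> 1"
        using T cSUP_upper[OF _ bdd, of u] by (simp add: C2_def numerical_radius_def)
      moreover have x: "x = complex_of_real (norm x) *s u"
        using False by (simp add: u_def vec_eq_iff)
      have "?f x = (norm x)\<^sup>2 * ?f u"
        by (subst (1 2) x)
          (simp add: matrix_vector_scale cinner_scale_left cinner_scale_right norm_mult power2_eq_square)
      ultimately show ?thesis
        by (simp add: mult_left_le)
    qed (simp add: cinner_zero_left)
  qed
next
  assume "\<forall>x. cmod (cinner (T *v x) x) \<le> (norm x)\<^sup>2"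
  then have "cmod (cinner (T *v x) x) \<le> 1" if "norm x = 1" for x
    using that by (metis one_power2)
  moreover have "norm (axis undefined 1 :: complex ^ 'n) = 1"
    by simp
  then have "{x :: complex ^ 'n. norm x = 1} \<noteq> {}"
    by blast
  ultimately show "T \<in> C2"
    unfolding C2_def numerical_radius_def by (auto intro: cSUP_least)
qed

section \<open>Resolvents and the Harnack kernel\<close>

definition resolvent :: "complex ^ 'n ^ 'n \<Rightarrow> complex \<Rightarrow> complex ^ 'n ^ 'n"
  where "resolvent T w = matrix_inv (mat 1 - w *\<^sub>C T)"

lemma pencil_mult: "(mat 1 - w *\<^sub>C T) *v x = x - w *s (T *v x)"
  by (simp add: matrix_vector_mult_diff_rdistrib scaleC_matrix_vector)

text \<open>A kernel vector satisfies \<open>x = w *s (T *v x)\<close>; pairing it with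
  \<open>x\<close> gives \<open>(norm x)\<^sup>2 \<le> cmod w * (norm x)\<^sup>2\<close>, which
  forces \<open>x = 0\<close>.\<close>

lemma pencil_invertible:
  fixes T :: "complex ^ 'n ^ 'n"
  assumes "T \<in> C2" "cmod w < 1"
  shows "invertible (mat 1 - w *\<^sub>C T)"
  unfolding invertible_left_inverse matrix_left_invertible_ker
proof (intro allI impI)
  fix x assume "(mat 1 - w *\<^sub>C T) *v x = 0"
  then have x: "x = w *s (T *v x)"
    by (simp add: pencil_mult)
  have "(norm x)\<^sup>2 = cmod (cinner (w *s (T *v x)) x)"
    using cinner_self[of x] x by (metis abs_of_nonneg norm_of_real zero_le_power2)
  also have "\<dots> \<le> cmod w * (norm x)\<^sup>2"
    using assms by (auto simp: C2_iff cinner_scale_left norm_mult intro!: mult_left_mono)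
  finally have "(1 - cmod w) * (norm x)\<^sup>2 \<le> 0"
    by (simp add: algebra_simps)
  then show "x = 0"
    using assms by (simp add: mult_le_0_iff)
qed

lemma matrix_inv_cancel:
  assumes "invertible A"
  shows "matrix_inv A ** A = mat 1" "A ** matrix_inv A = mat 1"
  using assms unfolding invertible_def matrix_inv_def by (metis (mono_tags, lifting) someI_ex)+

lemma matrix_inv_eqI:
  fixes A B :: "complex ^ 'n ^ 'n"
  assumes "A ** B = mat 1"
  shows "matrix_inv A = B"
proof -
  have "invertible A"
    using assms invertible_right_inverse by blast
  then show ?thesis
    by (metis assms matrix_inv_cancel(1) matrix_mul_assoc matrix_mul_lid matrix_mul_rid)
qed

lemma matrix_inv_conj_transpose:
  fixes A :: "complex ^ 'n ^ 'n"
  assumes "invertible A"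
  shows "matrix_inv (conj_transpose A) = conj_transpose (matrix_inv A)"
proof (rule matrix_inv_eqI)
  show "conj_transpose A ** conj_transpose (matrix_inv A) = mat 1"
  proof (rule matrix_eq[THEN iffD2], rule allI)
    fix x
    have "cinner (conj_transpose A *v (conj_transpose (matrix_inv A) *v x)) y = cinner x y" for y
      by (simp add: cinner_conj_transpose matrix_vector_mul_assoc[of "matrix_inv A"]
          matrix_inv_cancel[OF assms])
    then show "(conj_transpose A ** conj_transpose (matrix_inv A)) *v x = mat 1 *v x"
      by (metis cinner_axis_right matrix_vector_mul_assoc matrix_vector_mul_lid vec_eq_iff)
  qed
qed

lemma conj_transpose_pencil:
  "conj_transpose (mat 1 - cnj z *\<^sub>C T) = mat 1 - z *\<^sub>C conj_transpose T"
  by (auto simp: vec_eq_iff conj_transpose_def scaleC_matrix_def map_matrix_def transpose_def mat_def)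

context
  fixes T :: "complex ^ 'n ^ 'n" and w :: complex
  assumes T: "T \<in> C2" and w: "cmod w < 1"
begin

lemma pencil_resolvent: "resolvent T w *v x - w *s (T *v (resolvent T w *v x)) = x"
  unfolding pencil_mult[symmetric] resolvent_def
  by (simp add: matrix_vector_mul_assoc matrix_inv_cancel pencil_invertible T w)

lemma resolvent_pencil: "resolvent T w *v (x - w *s (T *v x)) = x"
  unfolding pencil_mult[symmetric] resolvent_def
  by (simp add: matrix_vector_mul_assoc matrix_inv_cancel pencil_invertible T w)

lemma resolvent_eq: "resolvent T w *v x = x + w *s (T *v (resolvent T w *v x))"
  using pencil_resolvent[of x] by (simp add: algebra_simps)

lemma resolvent_eqI: "y - w *s (T *v y) = x \<Longrightarrow> resolvent T w *v x = y"
  using resolvent_pencil[of y] by simp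

text \<open>This is positivity of the Harnack kernel. Substituting
  \<open>x = g - w *s (T *v g)\<close> turns the form into
  \<open>(norm g)\<^sup>2 - Re (w * cinner (T *v g) g)\<close>, and the numerical radius controls
  the second term.\<close>

lemma Re_resolvent_nonneg: "0 \<le> Re (cinner (resolvent T w *v x) x)"
proof -
  define g where "g = resolvent T w *v x"
  have "Re (cinner g x) = Re (cinner x g)"
    by (rule Re_cinner_commute)
  also have "\<dots> = Re (cinner (g - w *s (T *v g)) g)"
    using pencil_resolvent[of x] by (simp add: g_def)
  also have "\<dots> = (norm g)\<^sup>2 - Re (w * cinner (T *v g) g)"
    by (simp add: cinner_diff_left cinner_scale_left cinner_self)
  finally have "Re (cinner g x) = (norm g)\<^sup>2 - Re (w * cinner (T *v g) g)" .
  moreover have "Re (w * cinner (T *v g) g) \<le> cmod w * cmod (cinner (T *v g) g)"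
    by (metis complex_Re_le_cmod norm_mult)
  moreover have "\<dots> \<le> 1 * (norm g)\<^sup>2"
    using T w by (intro mult_mono) (auto simp: C2_iff)
  ultimately show ?thesis
    by (simp add: g_def)
qed

end

lemma harnack_kernel_eq:
  assumes "T \<in> C2" "cmod z < 1"
  shows "harnack_kernel z T = resolvent T (cnj z) + conj_transpose (resolvent T (cnj z))"
  using assms pencil_invertible[of T "cnj z"]
  by (simp add: harnack_kernel_def resolvent_def matrix_inv_conj_transpose[symmetric]
      conj_transpose_pencil)

lemma cinner_harnack_kernel:
  assumes "T \<in> C2" "cmod z < 1"
  shows "cinner (harnack_kernel z T *v x) x = of_real (2 * Re (cinner (resolvent T (cnj z) *v x) x))"
  by (simp add: harnack_kernel_eq[OF assms] matrix_vector_mult_add_rdistrib cinner_add_left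
      cinner_conj_transpose cinner_commute[of x] complex_add_cnj)

lemma loewner_le_harnack_kernel:
  fixes T0 T1 :: "complex ^ 'n ^ 'n"
  assumes "T1 \<in> C2" "T0 \<in> C2" "cmod z < 1"
  shows "loewner_le (harnack_kernel z T1) (d *\<^sub>R harnack_kernel z T0) \<longleftrightarrow>
    (\<forall>x. Re (cinner (resolvent T1 (cnj z) *v x) x) \<le> d * Re (cinner (resolvent T0 (cnj z) *v x) x))"
proof -
  have "d *\<^sub>R A = of_real d *\<^sub>C A" for A :: "complex ^ 'n ^ 'n"
    by (simp add: vec_eq_iff scaleC_matrix_def scaleR_conv_of_real[where 'a = complex])
  then have scale: "cinner ((d *\<^sub>R A) *v x) y = of_real d * cinner (A *v x) y"
    for A :: "complex ^ 'n ^ 'n" and x y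
    by (simp add: scaleC_matrix_vector cinner_scale_left)
  have "cinner ((d *\<^sub>R harnack_kernel z T0 - harnack_kernel z T1) *v x) x =
      of_real (2 * (d * Re (cinner (resolvent T0 (cnj z) *v x) x) -
        Re (cinner (resolvent T1 (cnj z) *v x) x)))" for x
    by (simp add: matrix_vector_mult_diff_rdistrib
        cinner_diff_left scale cinner_harnack_kernel assms right_diff_distrib)
  then show ?thesis
    by (simp add: loewner_le_def del: of_real_mult of_real_diff)
qed

text \<open>The kernels are Hermitian, so the reality clause of \<open>loewner_le\<close> holds
  automatically; the common factor 2 cancels, and conjugation permutes the disc, so
  \<open>cnj z\<close> may be renamed \<open>w\<close>.\<close>

lemma harnack_dominated_iff:
  fixes T0 T1 :: "complex ^ 'n ^ 'n"
  shows "harnack_dominated T1 T0 \<longleftrightarrow> T1 \<in> C2 \<and> T0 \<in> C2 \<and>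
    (\<exists>c::real. c \<ge> 1 \<and> (\<forall>w x. cmod w < 1 \<longrightarrow>
      Re (cinner (resolvent T1 w *v x) x) \<le> c\<^sup>2 * Re (cinner (resolvent T0 w *v x) x)))"
proof -
  have *: "(\<forall>z. cmod z < 1 \<longrightarrow> (\<forall>x. P (cnj z) x)) \<longleftrightarrow> (\<forall>w x. cmod w < 1 \<longrightarrow> P w x)"
    for P :: "complex \<Rightarrow> complex ^ 'n \<Rightarrow> bool"
    by (metis complex_cnj_cnj complex_mod_cnj)
  show ?thesis
    unfolding harnack_dominated_def *[symmetric]
    by (intro conj_cong refl ex_cong1 all_cong1 imp_cong) (simp add: loewner_le_harnack_kernel)
qed

text \<open>By Cramer's rule each coordinate is a quotient of polynomials in \<open>w\<close> whose
  denominator does not vanish in the disc.\<close>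

lemma holomorphic_resolvent:
  fixes T :: "complex ^ 'n ^ 'n"
  assumes "T \<in> C2"
  shows "(\<lambda>w. (resolvent T w *v x) $ i) holomorphic_on ball 0 1"
proof -
  have eq: "(resolvent T w *v x) $ i = det (\<chi> j k. if k = i then x $ j else (mat 1 - w *\<^sub>C T) $ j $ k)
      / det (mat 1 - w *\<^sub>C T)" if "w \<in> ball 0 1" for w
  proof -
    have "det (mat 1 - w *\<^sub>C T) \<noteq> 0"
      using that pencil_invertible[OF assms] by (simp add: invertible_det_nz[symmetric])
    moreover have "(mat 1 - w *\<^sub>C T) *v (resolvent T w *v x) = x"
      using that pencil_resolvent[OF assms, of w x] by (simp add: pencil_mult)
    ultimately show ?thesis
      by (subst (asm) cramer) (auto dest: arg_cong[where f = "\<lambda>y. y $ i"])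
  qed
  have "(\<lambda>w. det (\<chi> j k. if k = i then x $ j else (mat 1 - w *\<^sub>C T) $ j $ k)
      / det (mat 1 - w *\<^sub>C T)) holomorphic_on ball 0 1"
  proof (rule holomorphic_on_divide)
    have entry: "(\<lambda>w. (mat 1 - w *\<^sub>C T) $ j $ k) holomorphic_on ball 0 1" for j k
      by (auto simp: mat_def scaleC_matrix_def map_matrix_def intro!: holomorphic_intros)
    then show "(\<lambda>w. det (mat 1 - w *\<^sub>C T)) holomorphic_on ball 0 1"
      unfolding det_def by (intro holomorphic_intros)
    have "(\<lambda>w. (\<chi> j k. if k = i then x $ j else (mat 1 - w *\<^sub>C T) $ j $ k) $ j $ k)
        holomorphic_on ball 0 1" for j k
      using entry by (cases "k = i") simp_all
    then show "(\<lambda>w. det (\<chi> j k. if k = i then x $ j else (mat 1 - w *\<^sub>C T) $ j $ k))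
        holomorphic_on ball 0 1"
      unfolding det_def by (intro holomorphic_intros)
    show "det (mat 1 - w *\<^sub>C T) \<noteq> 0" if "w \<in> ball 0 1" for w
      using that pencil_invertible[OF assms] by (simp add: invertible_det_nz[symmetric])
  qed
  then show ?thesis
    by (rule holomorphic_transform) (simp add: eq)
qed

text \<open>The discriminant argument for the positive semidefinite real quadratic form
  \<open>Q x x\<close>. Its polarisation needs both \<open>Q x y\<close> and \<open>Q y x\<close>,
  since \<open>Q\<close> is not symmetric in general.\<close>

lemma Re_resolvent_Cauchy_Schwarz:
  fixes T :: "complex ^ 'n ^ 'n"
  assumes T: "T \<in> C2" and w: "cmod w < 1"
  defines "Q \<equiv> \<lambda>x y. Re (cinner (resolvent T w *v x) y)"
  shows "(Q x y + Q y x)\<^sup>2 \<le> 4 * Q x x * Q y y"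
proof -
  have "0 \<le> Q x x + (Q x y + Q y x) * t + Q y y * t\<^sup>2" for t :: real
  proof -
    have "0 \<le> Q (x + of_real t *s y) (x + of_real t *s y)"
      unfolding Q_def by (rule Re_resolvent_nonneg[OF T w])
    also have "\<dots> = Q x x + (Q x y + Q y x) * t + Q y y * t\<^sup>2"
      by (simp add: Q_def matrix_vector_right_distrib matrix_vector_scale cinner_add_left
          cinner_add_right cinner_scale_left cinner_scale_right power2_eq_square algebra_simps)
    finally show ?thesis .
  qed
  note quad = this
  have pos: "0 \<le> Q x x" "0 \<le> Q y y"
    unfolding Q_def by (auto intro: Re_resolvent_nonneg[OF T w])
  show ?thesis
  proof (cases "Q y y = 0")
    case True
    have "Q x y + Q y x = 0"
    proof (rule ccontr)
      assume ne: "Q x y + Q y x \<noteq> 0"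
      \<comment> \<open>With \<open>Q y y = 0\<close> the quadratic is affine in \<open>t\<close>,
        and at this \<open>t\<close> it takes the value -1.\<close>
      show False
        using quad[of "- (Q x x + 1) / (Q x y + Q y x)"] True ne by simp
    qed
    then show ?thesis
      using True by simp
  next
    case False
    then have "Q y y > 0"
      using pos by simp
    \<comment> \<open>This \<open>t\<close> is the vertex of the parabola.\<close>
    then have "Q x x + (Q x y + Q y x) * t + Q y y * t\<^sup>2
        = (4 * Q x x * Q y y - (Q x y + Q y x)\<^sup>2) / (4 * Q y y)"
      if "t = - (Q x y + Q y x) / (2 * Q y y)" for t
      unfolding that by (simp add: field_simps power2_eq_square)
    then show ?thesis
      using quad[of "- (Q x y + Q y x) / (2 * Q y y)"] \<open>Q y y > 0\<close>
      by (simp add: zero_le_divide_iff)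
  qed
qed

section \<open>Real parts of holomorphic functions on the unit disc\<close>

lemma Re_le_ball:
  assumes "H holomorphic_on ball 0 1" "continuous_on (cball 0 1) H"
    and "\<And>z. cmod z = 1 \<Longrightarrow> Re (H z) \<le> B" and "cmod z \<le> 1"
  shows "Re (H z) \<le> B"
  by (rule maximum_real_frontier[of H "cball 0 1"]) (use assms in auto)

text \<open>Otherwise the image would be open by the open mapping theorem and contain
  \<open>H 0\<close> plus a small positive real, a value with nonzero real part.\<close>

lemma constant_on_ball_if_Re_zero:
  assumes hol: "H holomorphic_on ball 0 1" and Re: "\<And>z. cmod z < 1 \<Longrightarrow> Re (H z) = 0"
    and z: "cmod z < 1"
  shows "H z = H 0"
proof -
  have "H constant_on ball 0 1"
  proof (rule ccontr)
    assume "\<not> H constant_on ball 0 1"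
    then have "open (H ` ball 0 1)"
      using open_mapping_thm[OF hol] by auto
    then obtain e where "e > 0" "ball (H 0) e \<subseteq> H ` ball 0 1"
      by (meson centre_in_ball image_eqI openE zero_less_one)
    moreover have "H 0 + of_real (e / 2) \<in> ball (H 0) e"
      using \<open>e > 0\<close> by (simp add: dist_norm)
    ultimately obtain z where "cmod z < 1" "H z = H 0 + of_real (e / 2)"
      by (auto simp: subset_iff image_iff) 
    then show False
      using Re[of z] Re[of 0] \<open>e > 0\<close> by simp
  qed
  then show ?thesis
    using z by (auto simp: constant_on_def)
qed

section \<open>Kernels degenerating at the boundary\<close>

text \<open>
  For \<open>cmod w = 1\<close> this is a function with the same real part as the polarised kernel at
  \<open>r * w\<close>, evaluated at \<open>v + w\<^sup>2 *s u\<close> and \<open>y\<close>, but it is holomorphic in \<open>w\<close>. The last three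
  summands come from expanding the resolvent to second order, which cancels the factor
  \<open>(cnj w)\<^sup>2\<close>, and conjugating the terms that still contain a power of \<open>cnj w\<close>.
\<close>

definition pairing ::
    "complex ^ 'n ^ 'n \<Rightarrow> complex ^ 'n \<Rightarrow> complex ^ 'n \<Rightarrow> complex ^ 'n \<Rightarrow> real \<Rightarrow> complex \<Rightarrow> complex"
  where "pairing T u v y r w =
    cinner (resolvent T (r * w) *v v) y + w\<^sup>2 * cinner (resolvent T (r * w) *v u) y +
    (cinner (resolvent T (r * w) *v y) v +
      of_real (r\<^sup>2) * cinner (resolvent T (r * w) *v y) (conj_transpose T *v (conj_transpose T *v u))) +
    (w\<^sup>2 * cinner u y + of_real r * w * cinner u (T *v y))"

context
  fixes T :: "complex ^ 'n ^ 'n" and u v :: "complex ^ 'n"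
  assumes T: "T \<in> C2"
begin

text \<open>For \<open>r < 1\<close> this ball contains the closed unit disc, as the maximum
  principle requires; for \<open>r = 1\<close> it is the open disc, where the limit function
  lives.\<close>

lemma pairing_holomorphic:
  assumes r: "0 < r" "r \<le> 1"
  shows "pairing T u v y r holomorphic_on ball 0 (1 / r)"
proof -
  have res: "(\<lambda>w. cinner (resolvent T (of_real r * w) *v x) z) holomorphic_on ball 0 (1 / r)" for x z
  proof -
    have "((\<lambda>w. cinner (resolvent T w *v x) z) \<circ> (\<lambda>w. of_real r * w)) holomorphic_on ball 0 (1 / r)"
    proof (rule holomorphic_on_compose_gen[where t = "ball 0 1"])
      show "(\<lambda>w. cinner (resolvent T w *v x) z) holomorphic_on ball 0 1"
        by (rule holomorphic_cinner) (rule holomorphic_resolvent[OF T])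
      show "(\<lambda>w. of_real r * w) ` ball 0 (1 / r) \<subseteq> ball (0 :: complex) 1"
        using r by (auto simp: norm_mult pos_less_divide_eq mult.commute)
    qed (intro holomorphic_intros)
    then show ?thesis
      by (simp add: o_def)
  qed
  show ?thesis
    unfolding pairing_def[abs_def] by (intro holomorphic_intros res)
qed

lemma Re_pairing_circle:
  assumes r: "0 < r" "r < 1" and w: "cmod w = 1"
  shows "Re (pairing T u v y r w) =
    Re (cinner (resolvent T (r * w) *v (v + w\<^sup>2 *s u)) y) +
    Re (cinner (resolvent T (r * w) *v y) (v + w\<^sup>2 *s u))"
proof -
  have rw: "cmod (r * w) < 1"
    using r w by (simp add: norm_mult)
  define g where "g = resolvent T (r * w) *v y"
  have ww: "cnj w * w = 1"
    using w by (metis complex_norm_square mult.commute of_real_1 one_power2)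
  have g: "g = y + (r * w) *s (T *v g)"
    unfolding g_def by (rule resolvent_eq[OF T rw])
  have "g = y + (r * w) *s (T *v (y + (r * w) *s (T *v g)))"
    using g by metis
  then have "cinner g u = cinner (y + (r * w) *s (T *v (y + (r * w) *s (T *v g)))) u"
    by metis
  also have "\<dots> = cinner y u + r * w * cinner (T *v y) u
      + r\<^sup>2 * w\<^sup>2 * cinner g (conj_transpose T *v (conj_transpose T *v u))"
    by (simp add: matrix_vector_right_distrib matrix_vector_scale cinner_add_left
        cinner_scale_left cinner_conj_transpose_right algebra_simps power2_eq_square)
  finally have "(cnj w)\<^sup>2 * cinner g u = (cnj w)\<^sup>2 * cinner y u + r * cnj w * (cnj w * w) * cinner (T *v y) u
      + r\<^sup>2 * (cnj w * w)\<^sup>2 * cinner g (conj_transpose T *v (conj_transpose T *v u))"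
    by (simp add: algebra_simps power2_eq_square)
  then have *: "(cnj w)\<^sup>2 * cinner g u = cnj (w\<^sup>2 * cinner u y + r * w * cinner u (T *v y))
      + r\<^sup>2 * cinner g (conj_transpose T *v (conj_transpose T *v u))"
    by (simp add: ww cinner_commute[of u])
  have "cinner (resolvent T (r * w) *v (v + w\<^sup>2 *s u)) y =
      cinner (resolvent T (r * w) *v v) y + w\<^sup>2 * cinner (resolvent T (r * w) *v u) y"
    by (simp add: matrix_vector_right_distrib matrix_vector_scale cinner_add_left cinner_scale_left)
  moreover have "cinner g (v + w\<^sup>2 *s u) = cinner g v + (cnj w)\<^sup>2 * cinner g u"
    by (simp add: cinner_add_right cinner_scale_right)
  moreover have "Re ((cnj w)\<^sup>2) = Re (w\<^sup>2)" "Im ((cnj w)\<^sup>2) = - Im (w\<^sup>2)"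
    by (simp_all flip: complex_cnj_power)
  ultimately show ?thesis
    unfolding pairing_def g_def[symmetric] * by simp
qed

text \<open>Cauchy-Schwarz bounds the real part on the circle by a quantity that tends to 0 as
  \<open>r\<close> tends to 1. The maximum principle, applied to the pairing and its negative,
  carries the bound to the fixed interior point \<open>w\<close>.\<close>

lemma Re_pairing_eq_0:
  assumes small: "\<And>r w. \<lbrakk>0 < r; r < 1; cmod w = 1\<rbrakk> \<Longrightarrow>
      Re (cinner (resolvent T (of_real r * w) *v (v + w\<^sup>2 *s u)) (v + w\<^sup>2 *s u)) \<le> B * (1 - r\<^sup>2)"
    and bounded: "\<And>w. cmod w < 1 \<Longrightarrow> Re (cinner (resolvent T w *v y) y) \<le> C"
    and w: "cmod w < 1"
  shows "Re (pairing T u v y 1 w) = 0"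
proof -
  have bound: "\<bar>Re (pairing T u v y r w)\<bar> \<le> sqrt (4 * (B * (1 - r\<^sup>2)) * C)" if r: "0 < r" "r < 1" for r
  proof -
    let ?S = "sqrt (4 * (B * (1 - r\<^sup>2)) * C)"
    have circle: "\<bar>Re (pairing T u v y r z)\<bar> \<le> ?S" if z: "cmod z = 1" for z
    proof -
      have rz: "cmod (r * z) < 1"
        using r z by (simp add: norm_mult)
      let ?x = "v + z\<^sup>2 *s u"
      have "(Re (pairing T u v y r z))\<^sup>2 \<le> 4 * Re (cinner (resolvent T (r * z) *v ?x) ?x)
          * Re (cinner (resolvent T (r * z) *v y) y)"
        unfolding Re_pairing_circle[OF r z] by (rule Re_resolvent_Cauchy_Schwarz[OF T rz])
      also have "\<dots> \<le> 4 * (B * (1 - r\<^sup>2)) * C"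
      proof (rule mult_mono)
        show "0 \<le> 4 * (B * (1 - r\<^sup>2))"
          using small[OF r z] Re_resolvent_nonneg[OF T rz, of ?x] by linarith
      qed (use small[OF r z] bounded[OF rz] Re_resolvent_nonneg[OF T rz] in auto)
      finally show ?thesis
        by (simp add: real_le_rsqrt)
    qed
    have hol: "pairing T u v y r holomorphic_on ball 0 (1 / r)"
      using pairing_holomorphic r by simp
    have sub: "cball (0 :: complex) 1 \<subseteq> ball 0 (1 / r)"
    proof
      fix z :: complex assume "z \<in> cball 0 1"
      moreover have "1 < 1 / r"
        using r by simp
      ultimately show "z \<in> ball 0 (1 / r)"
        by simp
    qed
    have hol1: "pairing T u v y r holomorphic_on ball 0 1"
      using hol by (rule holomorphic_on_subset) (use sub ball_subset_cball[of 0 "1::real"] in blast)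
    have cont: "continuous_on (cball 0 1) (pairing T u v y r)"
      by (rule continuous_on_subset[OF holomorphic_on_imp_continuous_on[OF hol] sub])
    have "Re (pairing T u v y r w) \<le> ?S"
      by (rule Re_le_ball[OF hol1 cont]) (use circle w in \<open>auto simp: abs_le_iff\<close>)
    moreover have "Re (- pairing T u v y r w) \<le> ?S"
      by (rule Re_le_ball[OF holomorphic_on_minus[OF hol1] continuous_on_minus[OF cont]])
        (use circle w in \<open>auto simp: abs_le_iff\<close>)
    ultimately show ?thesis
      by (simp add: abs_le_iff)
  qed
  \<comment> \<open>Since \<open>cmod w < 1\<close>, the point \<open>r * w\<close> stays in the
    open disc even at \<open>r = 1\<close>, so the limit is a plain evaluation.\<close>
  have res: "continuous_on {0..1} (\<lambda>r. cinner (resolvent T (of_real r * w) *v x) z)" for x z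
  proof (rule continuous_on_compose2[where t = "ball 0 1" and g = "\<lambda>w. cinner (resolvent T w *v x) z"])
    show "continuous_on (ball 0 1) (\<lambda>w. cinner (resolvent T w *v x) z)"
      by (intro holomorphic_on_imp_continuous_on holomorphic_cinner holomorphic_resolvent[OF T])
    show "(\<lambda>r. of_real r * w) ` {0..1} \<subseteq> ball 0 1"
      using w mult_left_le_one_le[of "cmod w"] by (force simp: norm_mult)
  qed (intro continuous_intros)
  have "continuous_on {0..1} (\<lambda>r. \<bar>Re (pairing T u v y r w)\<bar>)"
    unfolding pairing_def by (intro continuous_intros res)
  then have "((\<lambda>r. \<bar>Re (pairing T u v y r w)\<bar>) \<longlongrightarrow> \<bar>Re (pairing T u v y 1 w)\<bar>) (at_left 1)"
    by (auto simp: continuous_on_def at_within_Icc_at_left dest: bspec[of _ _ 1])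
  moreover have "((\<lambda>r. sqrt (4 * (B * (1 - r\<^sup>2)) * C)) \<longlongrightarrow> sqrt (4 * (B * (1 - 1\<^sup>2)) * C)) (at_left 1)"
    by (intro tendsto_intros)
  moreover have "\<forall>\<^sub>F r in at_left 1. \<bar>Re (pairing T u v y r w)\<bar> \<le> sqrt (4 * (B * (1 - r\<^sup>2)) * C)"
    using bound by (auto simp: eventually_at_left[of 0 "1::real"] intro: exI[of _ 0])
  ultimately have "\<bar>Re (pairing T u v y 1 w)\<bar> \<le> sqrt (4 * (B * (1 - 1\<^sup>2)) * C)"
    by (intro tendsto_le[of "at_left (1::real)"]) auto
  then show ?thesis
    by simp
qed

end

text \<open>The three sample points 1/2, -1/2 and 1/4 already determine the coefficients.\<close>

lemma cubic_coeffs_eq_0: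
  fixes a b c :: complex
  assumes "\<And>w. cmod w < 1 \<Longrightarrow> w * a + w\<^sup>2 * b - w ^ 3 * c = 0"
  shows "a = 0" "b = 0" "c = 0"
proof -
  have "4 * a + 2 * b - c = 0" "- 4 * a + 2 * b + c = 0" "16 * a + 4 * b - c = 0"
    using arg_cong[OF assms[of "1 / 2"], of "(*) 8"] arg_cong[OF assms[of "- 1 / 2"], of "(*) 8"]
      arg_cong[OF assms[of "1 / 4"], of "(*) 64"]
    by (simp_all add: power2_eq_square power3_eq_cube right_diff_distrib distrib_left)
  then have "b = 0" "c = 4 * a" "c = 16 * a"
    by algebra+
  then show "a = 0" "b = 0" "c = 0"
    by auto
qed

text \<open>The limit pairing is constant in \<open>w\<close> for every \<open>y\<close>. It is the
  sum of \<open>P\<close>, conjugate-linear in \<open>y\<close>, and \<open>L\<close>, linear in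
  \<open>y\<close>, so each of them is constant. Constancy of \<open>L\<close> gives the first
  relation, constancy of \<open>P\<close> the other three.\<close>

lemma boundary_kernel_relations:
  fixes T :: "complex ^ 'n ^ 'n"
  assumes T: "T \<in> C2"
    and small: "\<And>r w. \<lbrakk>0 < r; r < 1; cmod w = 1\<rbrakk> \<Longrightarrow>
      Re (cinner (resolvent T (of_real r * w) *v (v + w\<^sup>2 *s u)) (v + w\<^sup>2 *s u)) \<le> B * (1 - r\<^sup>2)"
    and bounded: "\<And>y. \<exists>C. \<forall>w. cmod w < 1 \<longrightarrow> Re (cinner (resolvent T w *v y) y) \<le> C"
  shows "conj_transpose T *v v = 0" "T *v u = 0" "conj_transpose T *v u + T *v v = 0"
    "T *v (conj_transpose T *v u) = 2 *s u"
proof -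
  let ?T' = "conj_transpose T"
  define P where "P = (\<lambda>y w. cinner (resolvent T w *v v + w\<^sup>2 *s (resolvent T w *v u)
    + w\<^sup>2 *s u + w *s (?T' *v u)) y)"
  define L where "L = (\<lambda>y w. cinner (resolvent T w *v y) (v + ?T' *v (?T' *v u)))"
  have pairing: "pairing T u v y 1 = (\<lambda>w. P y w + L y w)" for y
    by (simp add: fun_eq_iff pairing_def P_def L_def cinner_add_left cinner_add_right
        cinner_scale_left cinner_conj_transpose algebra_simps)
  have Re0: "Re (P y w + L y w) = 0" if "cmod w < 1" for y w
  proof -
    obtain C where C: "\<And>w. cmod w < 1 \<Longrightarrow> Re (cinner (resolvent T w *v y) y) \<le> C"
      using bounded by blast
    have "Re (pairing T u v y 1 w) = 0"
      using Re_pairing_eq_0[where T = T and u = u and v = v and B = B and C = C and y = y]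
        T small C that by blast
    then show ?thesis
      by (simp only: pairing)
  qed
  have const: "P y w + L y w = P y 0 + L y 0" if "cmod w < 1" for y w
  proof (rule constant_on_ball_if_Re_zero[OF _ _ that])
    show "(\<lambda>w. P y w + L y w) holomorphic_on ball 0 1"
      using pairing_holomorphic[OF T, of 1 u v y] by (simp add: pairing)
  qed (rule Re0)
  \<comment> \<open>Replacing \<open>y\<close> by \<open>\<i> *s y\<close> changes the relative sign
    of \<open>P\<close> and \<open>L\<close>, which separates them.\<close>
  have P_i: "P (\<i> *s y) w = - \<i> * P y w" and L_i: "L (\<i> *s y) w = \<i> * L y w" for y w
    by (simp_all add: P_def L_def matrix_vector_scale cinner_scale_left cinner_scale_right)
  have split: "P y w = P y 0 \<and> L y w = L y 0" if "cmod w < 1" for y w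
  proof -
    have "\<i> * (L y w - P y w) = \<i> * (L y 0 - P y 0)"
      using const[OF that, of "\<i> *s y"] by (simp add: P_i L_i algebra_simps)
    then have "L y w - P y w = L y 0 - P y 0"
      by simp
    moreover have "P y w + L y w = P y 0 + L y 0"
      by (rule const[OF that])
    ultimately have "2 * P y w = 2 * P y 0" "2 * L y w = 2 * L y 0"
      by algebra+
    then show ?thesis
      by simp
  qed
  have res0: "resolvent T 0 *v x = x" for x
    by (rule resolvent_eqI[OF T]) simp_all
  \<comment> \<open>The value at \<open>w = 0\<close>, used for \<open>y\<close> and for
    \<open>\<i> *s y\<close>, shows that applying \<open>?T'\<close> twice to \<open>u\<close> gives
    -2 times \<open>v\<close>; hence \<open>L\<close> reduces to a single resolvent term.\<close>
  have "Re (2 * cinner y v + cinner y (?T' *v (?T' *v u))) = 0" for y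
    using Re0[of 0 y] Re_cinner_commute[of y v]
    by (simp add: P_def L_def res0 cinner_add_right)
  from this this[of "\<i> *s y" for y]
  have eq: "cinner y (?T' *v (?T' *v u)) = - 2 * cinner y v" for y
    by (simp add: complex_eq_iff cinner_scale_left) (metis add.commute add_eq_0_iff2 minus_mult_left)+
  have L: "L y w = - cinner (resolvent T w *v y) v" for y w
    by (simp add: L_def cinner_add_right eq)
  \<comment> \<open>The argument is chosen so that the resolvent at 1/2 sends it to
    \<open>y\<close>; comparing \<open>L\<close> at 1/2 and at 0 then leaves only
    \<open>cinner (T *v y) v\<close>.\<close>
  have Tv: "cinner (T *v y) v = 0" for y
    using split[of "1 / 2" "y - (1 / 2) *s (T *v y)"] resolvent_pencil[OF T, of "1 / 2" y]
    by (simp add: L res0 cinner_diff_left cinner_scale_left)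
  have eq_0I: "x = 0" if "\<And>y. cinner x y = 0" for x :: "complex ^ 'n"
    using that by (metis cinner_axis_right vec_eq_iff zero_index)
  show "?T' *v v = 0"
    by (rule eq_0I) (metis Tv cinner_commute cinner_conj_transpose complex_cnj_zero)
  \<comment> \<open>Constancy of \<open>P\<close> makes the resolvent at
    \<open>v + w\<^sup>2 *s u\<close> an explicit quadratic in \<open>w\<close>; applying the pencil
    to it yields a cubic identity.\<close>
  have "w *s (?T' *v u + T *v v) + w\<^sup>2 *s (2 *s u - T *v (?T' *v u)) - w ^ 3 *s (T *v u) = 0"
    if w: "cmod w < 1" for w
  proof -
    have "resolvent T w *v v + w\<^sup>2 *s (resolvent T w *v u) + w\<^sup>2 *s u + w *s (?T' *v u) - v = 0"
      using split[OF w] by (intro eq_0I) (simp add: P_def res0 cinner_diff_left)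
    then have res: "resolvent T w *v (v + w\<^sup>2 *s u) = v - w\<^sup>2 *s u - w *s (?T' *v u)"
      by (simp add: matrix_vector_right_distrib matrix_vector_scale algebra_simps add_eq_0_iff)
    show ?thesis
      using pencil_resolvent[OF T w, of "v + w\<^sup>2 *s u"] unfolding res
      by (simp add: matrix_vector_right_distrib matrix_vector_mult_diff_distrib matrix_vector_scale
          vec_eq_iff power2_eq_square power3_eq_cube algebra_simps)
  qed
  from arg_cong[OF this, of _ "\<lambda>x. x $ i" for i]
  have "w * (?T' *v u + T *v v) $ i + w\<^sup>2 * (2 *s u - T *v (?T' *v u)) $ i - w ^ 3 * (T *v u) $ i = 0"
    if "cmod w < 1" for w i
    using that by (simp add: algebra_simps)
  note cubic_coeffs_eq_0[OF this]
  then show "T *v u = 0" "?T' *v u + T *v v = 0" "T *v (?T' *v u) = 2 *s u"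
    by (simp_all add: vec_eq_iff)
qed

section \<open>Weighted shifts on three coordinates\<close>

definition two_step :: "complex \<Rightarrow> complex \<Rightarrow> complex ^ 3 ^ 3"
  where "two_step p q = vector [vector [0, p, 0], vector [0, 0, q], vector [0, 0, 0]]"

lemma two_step_mult [simp]:
  "(two_step p q *v x) $ 1 = p * x $ 2" "(two_step p q *v x) $ 2 = q * x $ 3"
  "(two_step p q *v x) $ 3 = 0"
  by (simp_all add: two_step_def matrix_vector_mult_def sum_3)

lemma norm_vec3: "(norm x)\<^sup>2 = (cmod (x $ 1))\<^sup>2 + (cmod (x $ 2))\<^sup>2 + (cmod (x $ 3))\<^sup>2"
  for x :: "complex ^ 3"
  by (simp add: norm_vec_def L2_set_def sum_3)

text \<open>This is the resolvent form of \<open>two_step (a * cnj e) (a * e)\<close>: the matrix is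
  nilpotent of order three, so the Neumann series stops at the square, whose coefficient is free of
  \<open>e\<close> because \<open>cnj e * e = 1\<close>.\<close>

definition two_step_form :: "complex \<Rightarrow> complex \<Rightarrow> complex ^ 3 \<Rightarrow> complex \<Rightarrow> complex"
  where "two_step_form a e x w = of_real ((norm x)\<^sup>2)
    + w * (a * cnj e * (x $ 2) * cnj (x $ 1) + a * e * (x $ 3) * cnj (x $ 2))
    + w\<^sup>2 * (a\<^sup>2 * (x $ 3) * cnj (x $ 1))"

context
  fixes a e :: complex
  assumes a: "cmod a = sqrt 2" and e: "cmod e = 1"
begin

text \<open>Two completed squares suffice: one splits the product of \<open>?p + ?s\<close> and
  \<open>?q\<close>, the other compares \<open>(?p + ?s)\<^sup>2 / 2\<close> with
  \<open>?p\<^sup>2 + ?s\<^sup>2\<close>.\<close>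

lemma two_step_C2: "two_step (a * cnj e) (a * e) \<in> C2"
  unfolding C2_iff
proof
  fix x :: "complex ^ 3"
  let ?p = "cmod (x $ 1)" and ?q = "cmod (x $ 2)" and ?s = "cmod (x $ 3)"
  have "cmod (cinner (two_step (a * cnj e) (a * e) *v x) x) \<le> sqrt 2 * (?p * ?q) + sqrt 2 * (?s * ?q)"
    unfolding cinner_def sum_3
    by (simp, rule norm_triangle_le) (simp add: norm_mult a e mult_ac)
  also have "\<dots> = ((?p + ?s)\<^sup>2 / 2 + ?q\<^sup>2) - ((?p + ?s) / sqrt 2 - ?q)\<^sup>2"
    by (simp add: power2_diff power_divide field_simps)
  also have "\<dots> \<le> (?p + ?s)\<^sup>2 / 2 + ?q\<^sup>2"
    by simp
  also have "\<dots> = ?p\<^sup>2 + ?q\<^sup>2 + ?s\<^sup>2 - (?p - ?s)\<^sup>2 / 2"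
    by (simp add: power2_eq_square field_simps)
  also have "\<dots> \<le> (norm x)\<^sup>2"
    by (simp add: norm_vec3)
  finally show "cmod (cinner (two_step (a * cnj e) (a * e) *v x) x) \<le> (norm x)\<^sup>2" .
qed

lemma two_step_resolvent:
  assumes "cmod w < 1"
  shows "cinner (resolvent (two_step (a * cnj e) (a * e)) w *v x) x = two_step_form a e x w"
proof -
  let ?T = "two_step (a * cnj e) (a * e)"
  have ee: "cnj e * e = 1"
    using e by (metis complex_norm_square mult.commute of_real_1 one_power2)
  have "resolvent ?T w *v x = x + w *s (?T *v (x + w *s (?T *v x)))"
    by (rule resolvent_eqI[OF two_step_C2 assms]) (simp add: vec_eq_iff forall_3 algebra_simps)
  moreover have "cinner x x + w * cinner (?T *v x) x + w\<^sup>2 * cinner (?T *v (?T *v x)) x = two_step_form a e x w"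
    using ee unfolding two_step_form_def cinner_self
    by (simp add: cinner_def sum_3 power2_eq_square)
  ultimately show ?thesis
    by (simp add: matrix_vector_right_distrib matrix_vector_scale cinner_add_left
        cinner_scale_left algebra_simps power2_eq_square)
qed

text \<open>
  On the circle the form depends on \<open>x $ 1\<close> and \<open>x $ 3\<close> only through \<open>cnj k * x $ 1 + k * x $ 3\<close>,
  a combination that does not involve \<open>e\<close>.
\<close>

lemma Re_two_step_form_circle:
  fixes x :: "complex ^ 3"
  assumes w: "cmod w = 1"
  defines "k \<equiv> w * a / sqrt 2"
  defines "s \<equiv> (cmod (cnj k * x $ 1 + k * x $ 3))\<^sup>2 + (cmod (x $ 2))\<^sup>2"
  shows "\<bar>Re (two_step_form a e x w) - s\<bar> \<le> s / sqrt 2"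
proof -
  let ?z = "cnj k * x $ 1 + k * x $ 3"
  have wa: "w * a = sqrt 2 * k"
    by (simp add: k_def)
  have k: "cnj k * k = 1"
    using w a by (metis k_def complex_norm_square mult.commute of_real_1 one_power2 norm_mult
        norm_divide norm_of_real abs_of_nonneg real_sqrt_ge_zero mult_1 divide_self_if
        real_sqrt_eq_zero_cancel_iff zero_le_numeral zero_neq_numeral)
  have "two_step_form a e x w = of_real ((norm x)\<^sup>2)
    + sqrt 2 * (k * cnj e * x $ 2 * cnj (x $ 1) + k * e * x $ 3 * cnj (x $ 2))
    + 2 * (k\<^sup>2 * x $ 3 * cnj (x $ 1))"
  proof -
    have "w\<^sup>2 * a\<^sup>2 = 2 * k\<^sup>2"
      unfolding power_mult_distrib[symmetric] wa by (simp add: power_mult_distrib flip: of_real_power)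
    then show ?thesis
      unfolding two_step_form_def using wa by algebra
  qed
  moreover have "(cmod ?z)\<^sup>2 = (cmod (x $ 1))\<^sup>2 + (cmod (x $ 3))\<^sup>2 + 2 * Re (k\<^sup>2 * x $ 3 * cnj (x $ 1))"
  proof -
    have "complex_of_real ((cmod ?z)\<^sup>2) = (cnj k * k) * (x $ 1 * cnj (x $ 1)) + (cnj k * k) * (x $ 3 * cnj (x $ 3))
        + (k\<^sup>2 * x $ 3 * cnj (x $ 1) + cnj (k\<^sup>2 * x $ 3 * cnj (x $ 1)))"
      unfolding complex_norm_square by (simp add: power2_eq_square algebra_simps)
    then have "complex_of_real ((cmod ?z)\<^sup>2) = of_real ((cmod (x $ 1))\<^sup>2 + (cmod (x $ 3))\<^sup>2 + 2 * Re (k\<^sup>2 * x $ 3 * cnj (x $ 1)))"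
      unfolding k complex_add_cnj by (simp add: complex_norm_square del: of_real_power)
    then show ?thesis
      using of_real_eq_iff by blast
  qed
  \<comment> \<open>Conjugating one summand keeps its real part and lets both share the factor
    \<open>cnj e * x $ 2\<close>.\<close>
  moreover have "Re (k * cnj e * x $ 2 * cnj (x $ 1) + k * e * x $ 3 * cnj (x $ 2)) = Re (cnj e * x $ 2 * cnj ?z)"
  proof -
    have "Re (k * e * x $ 3 * cnj (x $ 2)) = Re (cnj (k * e * x $ 3 * cnj (x $ 2)))"
      by (simp only: cnj.sel)
    also have "cnj (k * e * x $ 3 * cnj (x $ 2)) = cnj e * x $ 2 * cnj (k * x $ 3)"
      by (simp add: mult_ac)
    finally have "Re (k * e * x $ 3 * cnj (x $ 2)) = Re (cnj e * x $ 2 * cnj (k * x $ 3))" .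
    moreover have "k * cnj e * x $ 2 * cnj (x $ 1) = cnj e * x $ 2 * cnj (cnj k * x $ 1)"
      by (simp add: mult_ac)
    ultimately show ?thesis
      by (simp only: complex_cnj_add distrib_left plus_complex.sel)
  qed
  \<comment> \<open>Only this cross term involves \<open>e\<close>, and the arithmetic-geometric
    mean inequality bounds it by a fraction of \<open>s\<close> below 1.\<close>
  ultimately have "Re (two_step_form a e x w) - s = sqrt 2 * Re (cnj e * x $ 2 * cnj ?z)"
    by (simp add: norm_vec3 s_def)
  also have "\<bar>\<dots>\<bar> \<le> sqrt 2 * (cmod (x $ 2) * cmod ?z)"
    using abs_Re_le_cmod[of "cnj e * x $ 2 * cnj ?z"] by (simp add: abs_mult norm_mult e del: complex_cnj_add)
  also have "\<dots> \<le> sqrt 2 * (s / 2)"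
    using sum_squares_bound[of "cmod (x $ 2)" "cmod ?z"] by (simp add: s_def)
  also have "\<dots> = s / sqrt 2"
    by (simp add: real_div_sqrt field_simps)
  finally show ?thesis .
qed

end

section \<open>The two inclusions\<close>

text \<open>On the circle the forms for \<open>e\<close> and \<open>f\<close> both lie within
  \<open>s / sqrt 2\<close> of the same \<open>s\<close>, so they are comparable; their weighted
  difference is a polynomial in \<open>w\<close>, and the maximum principle extends the comparison
  to the disc.\<close>

lemma two_step_dominated:
  assumes a: "cmod a = sqrt 2" and e: "cmod e = 1" and f: "cmod f = 1"
  shows "harnack_dominated (two_step (a * cnj e) (a * e)) (two_step (a * cnj f) (a * f))"
proof -
  \<comment> \<open>Its square is the ratio of \<open>1 + 1 / sqrt 2\<close> to
    \<open>1 - 1 / sqrt 2\<close>.\<close>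
  let ?c = "1 + sqrt 2"
  have "Re (two_step_form a e x w) \<le> ?c\<^sup>2 * Re (two_step_form a f x w)" if w: "cmod w < 1" for w x
  proof -
    let ?H = "\<lambda>w. two_step_form a e x w - of_real (?c\<^sup>2) * two_step_form a f x w"
    have hol: "?H holomorphic_on UNIV"
      unfolding two_step_form_def by (intro holomorphic_intros)
    have "Re (?H w) \<le> 0"
    proof (rule Re_le_ball[of ?H])
      fix z :: complex assume z: "cmod z = 1"
      define s where "s = (cmod (cnj (z * a / sqrt 2) * x $ 1 + (z * a / sqrt 2) * x $ 3))\<^sup>2 + (cmod (x $ 2))\<^sup>2"
      have "Re (two_step_form a e x z) \<le> s + s / sqrt 2"
        using Re_two_step_form_circle[OF a e z, of x] by (simp add: s_def abs_le_iff)
      also have "\<dots> = ?c\<^sup>2 * (s - s / sqrt 2)"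
        by (simp add: power2_eq_square field_simps)
      also have "\<dots> \<le> ?c\<^sup>2 * Re (two_step_form a f x z)"
        using Re_two_step_form_circle[OF a f z, of x] by (intro mult_left_mono) (simp_all add: s_def abs_le_iff)
      finally show "Re (?H z) \<le> 0"
        by (simp del: of_real_power)
    next
      show "?H holomorphic_on ball 0 1"
        using hol by (rule holomorphic_on_subset) simp
      show "continuous_on (cball 0 1) ?H"
        using holomorphic_on_imp_continuous_on[OF hol] by (rule continuous_on_subset) simp
    qed (use w in simp)
    then show ?thesis
      by (simp del: of_real_power)
  qed
  then show ?thesis
    using two_step_C2[OF a e] two_step_C2[OF a f]
    unfolding harnack_dominated_iff
    by (auto simp: two_step_resolvent[OF a e] two_step_resolvent[OF a f] intro!: exI[of _ ?c])
qed

lemma dominated_by_two_step: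
  fixes T :: "complex ^ 3 ^ 3"
  assumes a: "cmod a = sqrt 2" and dom: "harnack_dominated T (two_step a a)"
  obtains p where "cmod p = sqrt 2" "T = two_step p (a\<^sup>2 / 2 * cnj p)"
proof -
  let ?N = "two_step a a"
  define b where "b = a\<^sup>2 / 2"
  have b: "cmod b = 1" and ab: "a\<^sup>2 = 2 * b"
    using a by (simp_all add: b_def norm_divide norm_power)
  have bb: "b * cnj b = 1"
    using b by (metis complex_norm_square of_real_1 one_power2)
  \<comment> \<open>On the circle, \<open>x = v + w\<^sup>2 *s u\<close> has
    \<open>x $ 2 = 0\<close> and \<open>cnj k * x $ 1 + k * x $ 3 = 0\<close> for
    \<open>k = w * a / sqrt 2\<close>, so the form of \<open>?N\<close> vanishes there.\<close>
  define u v :: "complex ^ 3" where "u = vector [- b, 0, 0]" and "v = vector [0, 0, 1]"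
  have [simp]: "u $ 1 = - b" "u $ 2 = 0" "u $ 3 = 0" "v $ 1 = 0" "v $ 2 = 0" "v $ 3 = 1"
    by (simp_all add: u_def v_def)
  obtain c where T: "T \<in> C2" and c: "\<And>w x. cmod w < 1 \<Longrightarrow>
      Re (cinner (resolvent T w *v x) x) \<le> c\<^sup>2 * Re (cinner (resolvent ?N w *v x) x)"
    using dom unfolding harnack_dominated_iff by blast
  have N: "cinner (resolvent ?N w *v x) x = two_step_form a 1 x w" if "cmod w < 1" for w x
    using two_step_resolvent[OF a norm_one that] by simp
  note form = two_step_form_def[of a 1]
  have small: "Re (cinner (resolvent T (of_real r * w) *v (v + w\<^sup>2 *s u)) (v + w\<^sup>2 *s u))
      \<le> 2 * c\<^sup>2 * (1 - r\<^sup>2)" if r: "0 < r" "r < 1" and w: "cmod w = 1" for r w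
  proof -
    let ?x = "v + w\<^sup>2 *s u"
    have rw: "cmod (r * w) < 1"
      using r w by (simp add: norm_mult)
    have ww: "w * cnj w = 1"
      using w by (metis complex_norm_square of_real_1 one_power2)
    have "two_step_form a 1 ?x (r * w) = 2 - 2 * of_real (r\<^sup>2) * (w * cnj w)\<^sup>2 * (b * cnj b)"
      by (simp add: form norm_vec3 norm_mult norm_power w b ab power_mult_distrib)
    then have "Re (two_step_form a 1 ?x (r * w)) = 2 * (1 - r\<^sup>2)"
      by (simp add: ww bb del: of_real_power)
    then show ?thesis
      using c[OF rw, of ?x] N[OF rw, of ?x] by (simp add: mult.assoc mult.left_commute[of 2])
  qed
  \<comment> \<open>The form of \<open>?N\<close> is a polynomial in \<open>w\<close>, hence bounded
    on the disc, and domination passes the bound to \<open>T\<close>.\<close>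
  have bounded: "\<exists>C. \<forall>w. cmod w < 1 \<longrightarrow> Re (cinner (resolvent T w *v y) y) \<le> C" for y
  proof -
    have "Re (cinner (resolvent T w *v y) y) \<le> c\<^sup>2 * ((norm y)\<^sup>2
        + cmod (a * (y $ 2) * cnj (y $ 1) + a * (y $ 3) * cnj (y $ 2)) + cmod (a\<^sup>2 * (y $ 3) * cnj (y $ 1)))"
      (is "_ \<le> c\<^sup>2 * (_ + cmod ?P + cmod ?R)") if w: "cmod w < 1" for w
    proof -
      have "cmod (w * ?P) \<le> cmod ?P" "cmod (w\<^sup>2 * ?R) \<le> cmod ?R"
        using w by (simp_all only: norm_mult norm_power) (auto intro!: mult_left_le_one_le power_le_one)
      then have "Re (two_step_form a 1 y w) \<le> (norm y)\<^sup>2 + cmod ?P + cmod ?R"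
        using complex_Re_le_cmod[of "w * ?P"] complex_Re_le_cmod[of "w\<^sup>2 * ?R"]
        unfolding form complex_cnj_one mult_1_right plus_complex.sel Re_complex_of_real by linarith
      then have "c\<^sup>2 * Re (two_step_form a 1 y w) \<le> c\<^sup>2 * ((norm y)\<^sup>2 + cmod ?P + cmod ?R)"
        by (rule mult_left_mono) simp
      then show ?thesis
        using c[OF w, of y] N[OF w, of y] by simp
    qed
    then show ?thesis
      by blast
  qed
  note rel = boundary_kernel_relations[where v = v and u = u and B = "2 * c\<^sup>2", OF T small bounded]
  have T': "(conj_transpose T *v x) $ i = (\<Sum>j\<in>UNIV. cnj (T $ j $ i) * x $ j)" for x i
    by (simp add: matrix_vector_mult_def conj_transpose_def transpose_def)
  have Tx: "(T *v x) $ i = (\<Sum>j\<in>UNIV. T $ i $ j * x $ j)" for x i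
    by (simp add: matrix_vector_mult_def)
  define p where "p = T $ 1 $ 2"
  have b0: "b \<noteq> 0"
    using b norm_zero by force
  have rel1: "(conj_transpose T *v v) $ i = 0" and rel2: "(T *v u) $ i = 0"
    and rel3: "(conj_transpose T *v u) $ i + (T *v v) $ i = 0"
    and rel4: "(T *v (conj_transpose T *v u)) $ i = 2 * u $ i" for i
    by (simp_all only: rel vector_add_component[symmetric] zero_index vector_smult_component)
  \<comment> \<open>Read entrywise, the relations clear the last row and the first column, tie
    \<open>T $ 2 $ 3\<close> to \<open>p\<close>, and finally give \<open>cmod p = sqrt 2\<close>
    and \<open>T $ 2 $ 2 = 0\<close>.\<close>
  have row3: "T $ 3 $ i = 0" for i
    using rel1[of i] by (simp add: T' sum_3)
  have col1: "T $ i $ 1 = 0" for i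
    using rel2[of i] b0 by (simp add: Tx sum_3)
  have T13: "T $ 1 $ 3 = 0" and T23: "T $ 2 $ 3 = b * cnj p"
    using rel3[of 1] rel3[of 2] by (simp_all add: T' Tx sum_3 col1 p_def add_eq_0_iff2)
  have "p * (b * cnj p) = 2 * b"
    using rel4[of 1] by (simp add: Tx T' sum_3 col1 T13 p_def)
  then have pp: "p * cnj p = 2"
    using b0 by (simp add: mult.left_commute)
  then have p: "cmod p = sqrt 2"
    by (metis complex_norm_square norm_ge_zero of_real_eq_iff of_real_numeral real_sqrt_unique)
  have "T $ 2 $ 2 * (b * cnj p) = 0"
    using rel4[of 2] by (auto simp: Tx T' sum_3 col1 T13 p_def)
  then have T22: "T $ 2 $ 2 = 0"
    using b0 pp by auto
  have "T = two_step p (b * cnj p)"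
    using row3 col1 T13 T23 T22 by (simp add: vec_eq_iff forall_3 two_step_def p_def)
  then show thesis
    using that p by (simp add: b_def)
qed

theorem theorem3p3:
  fixes a :: complex and N :: "complex ^ 3 ^ 3"
  assumes "cmod a = sqrt 2"
    and "N = vector [vector [0, a, 0],
                     vector [0, 0, a],
                     vector [0, 0, 0]]"
  shows "harnack_part N =
    {T \<in> C2. \<exists>\<theta>::real.
       T = a *\<^sub>C vector [vector [0, exp (- (\<i> * complex_of_real \<theta>)), 0],
                        vector [0, 0, exp (\<i> * complex_of_real \<theta>)],
                        vector [0, 0, 0]]}"
proof -
  have N: "N = two_step a a"
    by (simp add: assms(2) two_step_def)
  have rotated: "a *\<^sub>C vector [vector [0, exp (- (\<i> * complex_of_real \<theta>)), 0],
      vector [0, 0, exp (\<i> * complex_of_real \<theta>)], vector [0, 0, 0]]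
    = two_step (a * cnj (exp (\<i> * \<theta>))) (a * exp (\<i> * \<theta>))" for \<theta>
    by (simp add: vec_eq_iff forall_3 two_step_def scaleC_matrix_def exp_cnj)
  show ?thesis
    unfolding rotated harnack_part_def
  proof (intro Collect_cong iffI conjI)
    fix T
    assume "harnack_equivalent T N"
    then have dom: "harnack_dominated T (two_step a a)"
      by (simp add: harnack_equivalent_def N)
    then show "T \<in> C2"
      by (simp add: harnack_dominated_def)
    obtain p where p: "cmod p = sqrt 2" and T: "T = two_step p (a\<^sup>2 / 2 * cnj p)"
      using dominated_by_two_step[OF assms(1) dom] .
    have a0: "a \<noteq> 0"
      using assms(1) by auto
    have aa: "a * cnj a = 2"
      unfolding complex_norm_square[symmetric] assms(1) by simp
    \<comment> \<open>Chosen so that \<open>p = a * cnj e\<close>; the other weight then equals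
      \<open>a * e\<close> because \<open>a * cnj a = 2\<close>.\<close>
    define e where "e = cnj (p / a)"
    have e: "cmod e = 1"
      using assms(1) by (simp add: e_def norm_divide p)
    then have "e = exp (\<i> * Arg e)"
      using Arg_eq[of e] by fastforce
    moreover have "p = a * cnj e"
      using a0 by (simp add: e_def)
    moreover from this have "a\<^sup>2 / 2 * cnj p = a * e * (a * cnj a) / 2"
      by (simp add: power2_eq_square)
    then have "a\<^sup>2 / 2 * cnj p = a * e"
      by (simp add: aa)
    ultimately show "\<exists>\<theta>. T = two_step (a * cnj (exp (\<i> * complex_of_real \<theta>))) (a * exp (\<i> * complex_of_real \<theta>))"
      unfolding T by metis
  next
    fix T
    assume "T \<in> C2 \<and> (\<exists>\<theta>. T = two_step (a * cnj (exp (\<i> * complex_of_real \<theta>))) (a * exp (\<i> * complex_of_real \<theta>)))"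
    then obtain \<theta> where "T = two_step (a * cnj (exp (\<i> * complex_of_real \<theta>))) (a * exp (\<i> * complex_of_real \<theta>))"
      by blast
    \<comment> \<open>\<open>N\<close> is the case \<open>e = 1\<close> of the family.\<close>
    then show "harnack_equivalent T N"
      using two_step_dominated[OF assms(1), of "exp (\<i> * \<theta>)" 1] two_step_dominated[OF assms(1), of 1 "exp (\<i> * \<theta>)"]
      by (simp add: harnack_equivalent_def N)
  qed
qed

end
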